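(* Let $\mathcal{H}$ be a real Hilbert space and suppose that the standing assumptions listed in the context hold, with $\lambda_k\equiv1$. Let $\{u_k\},\{z_k\},\{x_k\}$ be generated by the non-stationary Forward--Douglas--Rachford iteration: $z_0\in\mathcal{H}$, $x_0=\mathrm{P}_V(z_0)$ and, for $k\ge 0$, $$u_{k+1}=\mathrm{prox}_{\gamma_k R}\big(2x_k-z_k-\gamma_k\nabla G(x_k)\big),\quad z_{k+1}=z_k+u_{k+1}-x_k,\quad x_{k+1}=\mathrm{P}_V(z_{k+1}),$$ with $u_0\in\operatorname{dom}R$ arbitrary. Let $z^\star\in\mathrm{fix}(\mathscr{F}_\gamma)$, $x^\star=\mathrm{P}_V(z^\star)\in\operatorname{Argmin}(\Phi_V)$, and let $v^\star\in V^\perp\cap\big(\partial R(x^\star)+\nabla G(x^\star)\big)$. If $v^\star$ is bounded (i.e. $\|v^\star\|<+\infty$), then, for $k\ge 0$, $$\inf_{0\le i\le k}\mathcal{D}_\Phi^{v^\star}(u_i)=o\big((k+1)^{-1}\big)\quad\text{and}\quad \mathcal{D}_\Phi^{v^\star}(\bar u_k)=O\big(1/(k+1)\big),\qquad\text{where } \bar u_k=\frac1{k+1}\sum_{i=0}^k u_i .$$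
   Context: Standing assumptions. $\Gamma_0(\mathcal{H})$ is the set of proper convex lower semicontinuous functions $\mathcal{H}\to\,]-\infty,+\infty]$. $R\in\Gamma_0(\mathcal{H})$. $F:\mathcal{H}\to\mathbb{R}$ is convex, continuously differentiable, with $\nabla F$ being $(1/\beta)$-Lipschitz for some $\beta>0$. $V$ is a closed vector subspace of $\mathcal{H}$ with orthogonal projector $\mathrm{P}_V$. Set $G:=F\circ \mathrm{P}_V$, so $\nabla G=\mathrm{P}_V\circ\nabla F\circ\mathrm{P}_V$; $\beta_V\ge\beta$ is a constant such that $\nabla G$ is $(1/\beta_V)$-Lipschitz. $\Phi_V:=G+R+\iota_V$ ($\iota_V$ the indicator function of $V$), and $\operatorname{Argmin}(\Phi_V)\neq\emptyset$. Parameters: $0<\underline{\gamma}\le\gamma_k\le\overline{\gamma}<2\beta_V$ and $\gamma_k\to\gamma\in[\underline{\gamma},\overline{\gamma}]$; $\lambda_k\in\,]0,\frac{4\beta_V-\gamma_k}{2\beta_V}[$; $\sum_{k}\lambda_k\big(\frac{4\beta_V-\gamma_k}{2\beta_V}-\lambda_k\big)=+\infty$; $\sum_{k}\lambda_k|\gamma_k-\gamma|<+\infty$ (with $\lambda_k\equiv1$ here, so the last condition reads $\sum_k|\gamma_k-\gamma|<+\infty$). Notation: $\mathrm{prox}_{\gamma R}(x)=\operatorname{argmin}_{u}\gamma R(u)+\frac12\|u-x\|^2$; $\mathcal{R}_{\gamma R}=2\,\mathrm{prox}_{\gamma R}-\mathrm{Id}$; $\mathcal{R}_V=2\mathrm{P}_V-\mathrm{Id}$;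 $\mathscr{F}_\gamma=\frac12(\mathrm{Id}+\mathcal{R}_{\gamma R}\circ\mathcal{R}_V)\circ(\mathrm{Id}-\gamma\nabla G)$; $\mathrm{fix}(\mathscr{F}_\gamma)$ is its set of fixed points. With $\Phi:=R+G$, the Bregman divergence used is $\mathcal{D}_\Phi^{v^\star}(y):=\Phi(y)-\Phi(x^\star)-\langle v^\star,y-x^\star\rangle$, $y\in\mathcal{H}$. *)

theory Defs
  imports "HOL-Analysis.Analysis" "HOL-Library.Landau_Symbols"
begin

text \<open>
  A real Hilbert space is a type of sort \<open>{real_inner, complete_space}\<close>, of any dimension.
  Functions with values in \<open>]-\<infinity>, +\<infinity>]\<close> have type \<open>'a \<Rightarrow> ereal\<close> and
  satisfy \<open>proper_fun\<close>, so that the sums below never meet \<open>\<infinity> + (-\<infinity>)\<close>.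
\<close>

definition dom_fun :: "('a \<Rightarrow> ereal) \<Rightarrow> 'a set" where
  "dom_fun f = {x. f x < \<infinity>}"

definition proper_fun :: "('a \<Rightarrow> ereal) \<Rightarrow> bool" where
  "proper_fun f \<longleftrightarrow> (\<forall>x. f x \<noteq> -\<infinity>) \<and> dom_fun f \<noteq> {}"

text \<open>
  The weights are restricted to the open interval, where \<open>ereal t * \<infinity> = \<infinity>\<close>
  (at the end points \<open>0 * \<infinity> = 0\<close> and the inequality is trivial).
\<close>
definition convex_fun :: "('a::real_vector \<Rightarrow> ereal) \<Rightarrow> bool" where
  "convex_fun f \<longleftrightarrow>
     (\<forall>x y t. 0 < t \<and> t < 1 \<longrightarrow>
        f ((1 - t) *\<^sub>R x + t *\<^sub>R y) \<le> ereal (1 - t) * f x + ereal t * f y)"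

definition lsc_fun :: "('a::topological_space \<Rightarrow> ereal) \<Rightarrow> bool" where
  "lsc_fun f \<longleftrightarrow> (\<forall>x. f x \<le> Liminf (nhds x) f)"

definition Gamma0 :: "('a::real_normed_vector \<Rightarrow> ereal) set" where
  "Gamma0 = {f. proper_fun f \<and> convex_fun f \<and> lsc_fun f}"

definition Argmin :: "('a \<Rightarrow> ereal) \<Rightarrow> 'a set" where
  "Argmin f = {x. is_arg_min f (\<lambda>_. True) x}"

definition ind_fun :: "'a set \<Rightarrow> 'a \<Rightarrow> ereal" where
  "ind_fun V x = (if x \<in> V then 0 else \<infinity>)"

definition subdiff :: "('a::real_inner \<Rightarrow> ereal) \<Rightarrow> 'a \<Rightarrow> 'a set" where
  "subdiff f x = {v. \<forall>y. f x + ereal (v \<bullet> (y - x)) \<le> f y}"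

definition grad :: "('a::real_inner \<Rightarrow> real) \<Rightarrow> 'a \<Rightarrow> 'a" where
  "grad f x = (THE D. GDERIV f x :> D)"

text \<open>
  The library's \<open>closest_point\<close> requires \<open>heine_borel\<close>, hence finite dimension.
  For \<open>V\<close> a closed subspace of a Hilbert space the description is satisfied by exactly one point.
\<close>
definition proj :: "'a::real_inner set \<Rightarrow> 'a \<Rightarrow> 'a" where
  "proj V x = (THE p. p \<in> V \<and> x - p \<in> orthogonal_comp V)"

text \<open>For \<open>R \<in> Gamma0\<close> and \<open>\<gamma> > 0\<close> the minimizer exists and is unique.\<close>
definition prox :: "real \<Rightarrow> ('a::real_inner \<Rightarrow> ereal) \<Rightarrow> 'a \<Rightarrow> 'a" where
  "prox \<gamma> R x =
     arg_min (\<lambda>u. ereal \<gamma> * R u + ereal (1 / 2 * (norm (u - x))\<^sup>2)) (\<lambda>_. True)"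

text \<open>The reflection \<open>2 T - Id\<close> of an operator \<open>T\<close>.\<close>
definition refl_op :: "('a::real_vector \<Rightarrow> 'a) \<Rightarrow> 'a \<Rightarrow> 'a" where
  "refl_op T x = 2 *\<^sub>R T x - x"

definition FDR_op ::
  "real \<Rightarrow> ('a::real_inner \<Rightarrow> ereal) \<Rightarrow> 'a set \<Rightarrow> ('a \<Rightarrow> real) \<Rightarrow> 'a \<Rightarrow> 'a" where
  "FDR_op \<gamma> R V G =
     (\<lambda>w. (1 / 2) *\<^sub>R (w + refl_op (prox \<gamma> R) (refl_op (proj V) w)))
     \<circ> (\<lambda>z. z - \<gamma> *\<^sub>R grad G z)"

definition fixpts :: "('a \<Rightarrow> 'a) \<Rightarrow> 'a set" where
  "fixpts T = {z. T z = z}"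

text \<open>Meaningful when \<open>\<Phi> xs\<close> is finite.\<close>
definition bregman :: "('a::real_inner \<Rightarrow> ereal) \<Rightarrow> 'a \<Rightarrow> 'a \<Rightarrow> 'a \<Rightarrow> ereal" where
  "bregman \<Phi> xs v y = \<Phi> y - \<Phi> xs - ereal (v \<bullet> (y - xs))"

end

theory Submission
  imports Defs
begin

text \<open>
  Let \<open>E k = (norm (z k - xs + \<gamma>lim *\<^sub>R vs))\<^sup>2\<close>, \<open>s k = (norm (z (k+1) - z k))\<^sup>2\<close>,
  \<open>\<delta> k = \<gamma> k - \<gamma>lim\<close> and \<open>P k = (x k - z (k+1) - \<gamma> k *\<^sub>R vs) \<bullet> (u (k+1) - xs)\<close>.
  Orthogonality of \<open>V\<close> and its complement gives
  \<open>2 * P k = E k - E (k+1) - s k - 2 * \<delta> k * ((z (k+1) - z k) \<bullet> vs)\<close>.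
  Monotonicity of the subdifferential of \<open>R\<close> and cocoercivity of the gradient of \<open>G\<close> bound
  \<open>2 * P k\<close> below by \<open>- \<gamma> k / (2 * \<beta>V) * s k\<close>; as \<open>\<gamma>max < 2 * \<beta>V\<close> and \<open>\<delta>\<close> is square summable,
  telescoping shows that \<open>s\<close> is summable. The subgradient inequality for \<open>R\<close> and the descent
  lemma for \<open>G\<close> bound \<open>\<gamma> k\<close> times the divergence of \<open>u (k+1)\<close> above by
  \<open>P k + \<gamma> k / (2 * \<beta>V) * s k\<close>, so the divergences are summable too. Both rates follow, the second
  one by convexity of the divergence.
\<close>

subsection \<open>Proximal points and orthogonal projections in Hilbert space\<close>

lemma Gamma0_real:
  assumes "f \<in> Gamma0" and "x \<in> dom_fun f"
  shows "f x = ereal (real_of_ereal (f x))"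
proof -
  have "f x \<noteq> -\<infinity>" "f x \<noteq> \<infinity>"
    using assms by (auto simp: Gamma0_def proper_fun_def dom_fun_def)
  then show ?thesis
    by (cases "f x") auto
qed

text \<open>Passes from extended values to real ones on the domain, so that library facts on
  \<open>convex_on\<close> apply. The end weights 0 and 1, outside the range of
  \<open>convex_fun\<close>, are settled separately.\<close>

lemma Gamma0_convex_on:
  assumes f: "f \<in> Gamma0"
  shows "convex_on (dom_fun f) (\<lambda>x. real_of_ereal (f x))"
proof -
  have key: "(1 - t) *\<^sub>R x + t *\<^sub>R y \<in> dom_fun f \<and>
      real_of_ereal (f ((1 - t) *\<^sub>R x + t *\<^sub>R y))
        \<le> (1 - t) * real_of_ereal (f x) + t * real_of_ereal (f y)"
    if "0 < t" "t < 1" and x: "x \<in> dom_fun f" and y: "y \<in> dom_fun f" for t x y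
  proof -
    have "f ((1 - t) *\<^sub>R x + t *\<^sub>R y) \<le> ereal (1 - t) * f x + ereal t * f y"
      using f that by (auto simp: Gamma0_def convex_fun_def)
    also have "\<dots> = ereal ((1 - t) * real_of_ereal (f x) + t * real_of_ereal (f y))"
      by (subst Gamma0_real[OF f x], subst Gamma0_real[OF f y]) simp
    finally have le: "f ((1 - t) *\<^sub>R x + t *\<^sub>R y)
        \<le> ereal ((1 - t) * real_of_ereal (f x) + t * real_of_ereal (f y))" .
    then have dom: "(1 - t) *\<^sub>R x + t *\<^sub>R y \<in> dom_fun f"
      by (auto simp: dom_fun_def intro: le_less_trans)
    with le show ?thesis
      using Gamma0_real[OF f dom] by (cases "f ((1 - t) *\<^sub>R x + t *\<^sub>R y)") auto
  qed
  show ?thesis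
  proof (rule convex_onI)
    show "convex (dom_fun f)"
      unfolding convex_alt
    proof (intro ballI allI impI)
      fix x y and t :: real
      assume "x \<in> dom_fun f" "y \<in> dom_fun f" "0 \<le> t \<and> t \<le> 1"
      then show "(1 - t) *\<^sub>R x + t *\<^sub>R y \<in> dom_fun f"
        using key[of t x y] by (cases "t = 0 \<or> t = 1") auto
    qed
  qed (use key in blast)
qed

text \<open>An infinite value at \<open>x\<close> would force infinite values everywhere, against
  properness.\<close>

lemma subdiff_dom:
  assumes f: "f \<in> Gamma0" and v: "v \<in> subdiff f x"
  shows "x \<in> dom_fun f"
proof -
  obtain y where "f y < \<infinity>"
    using f by (auto simp: Gamma0_def proper_fun_def dom_fun_def)
  moreover have "f x + ereal (v \<bullet> (y - x)) \<le> f y"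
    using v by (auto simp: subdiff_def)
  ultimately show ?thesis
    by (cases "f x") (auto simp: dom_fun_def)
qed

lemma subdiff_real:
  assumes f: "f \<in> Gamma0" and v: "v \<in> subdiff f x" and y: "y \<in> dom_fun f"
  shows "real_of_ereal (f x) + v \<bullet> (y - x) \<le> real_of_ereal (f y)"
proof -
  have "f x + ereal (v \<bullet> (y - x)) \<le> f y"
    using v by (auto simp: subdiff_def)
  then show ?thesis
    using Gamma0_real[OF f y] Gamma0_real[OF f subdiff_dom[OF f v]]
    by (cases "f x"; cases "f y") auto
qed

text \<open>Any \<open>y\<close> below \<open>f x\<close> is eventually below
  \<open>f (p n)\<close>, hence at most \<open>c n\<close>, hence at most \<open>l\<close>;
  \<open>dense_le\<close> then lets \<open>y\<close> rise to \<open>f x\<close>.\<close>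

lemma lsc_fun_le_limit:
  assumes f: "lsc_fun f" and p: "p \<longlonglongrightarrow> x"
    and le: "\<And>n. f (p n) \<le> ereal (c n)" and c: "c \<longlonglongrightarrow> l"
  shows "f x \<le> ereal l"
proof (rule dense_le)
  fix y assume "y < f x"
  moreover have "f x \<le> Liminf (nhds x) f"
    using f by (simp add: lsc_fun_def)
  ultimately have "\<forall>\<^sub>F z in nhds x. y < f z"
    by (simp add: le_Liminf_iff)
  then have "\<forall>\<^sub>F n in sequentially. y < f (p n)"
    using p by (rule eventually_compose_filterlim)
  then have "\<forall>\<^sub>F n in sequentially. y \<le> ereal (c n)"
    by eventually_elim (use le less_le_trans less_imp_le in blast)
  moreover have "(\<lambda>n. ereal (c n)) \<longlonglongrightarrow> ereal l"
    using c by simp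
  ultimately show "y \<le> ereal l"
    by (intro tendsto_lowerbound) auto
qed

text \<open>The subgradient \<open>w\<close> supplies an affine minorant of \<open>f\<close>, which
  keeps the proximal objective bounded below. The quadratic term makes it strongly convex, so a
  minimizing sequence is Cauchy; completeness gives a limit and lower semicontinuity its
  minimality.\<close>

lemma prox_exists:
  fixes f :: "'a::{real_inner, complete_space} \<Rightarrow> ereal"
  assumes f: "f \<in> Gamma0" and w: "w \<in> subdiff f a" and \<gamma>: "\<gamma> > 0"
  shows "\<exists>p. is_arg_min (\<lambda>u. ereal \<gamma> * f u + ereal (1 / 2 * (norm (u - x))\<^sup>2)) (\<lambda>_. True) p"
proof -
  define r where "r u = real_of_ereal (f u)" for u
  define \<phi> where "\<phi> u = \<gamma> * r u + 1 / 2 * (norm (u - x))\<^sup>2" for u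
  let ?D = "dom_fun f"
  have fr: "f u = ereal (r u)" if "u \<in> ?D" for u
    using Gamma0_real[OF f that] by (simp add: r_def)
  have conv: "convex_on ?D r"
    using Gamma0_convex_on[OF f] by (simp add: r_def[abs_def])
  have aD: "a \<in> ?D"
    using f w by (rule subdiff_dom)
  \<comment> \<open>The subgradient inequality at \<open>a\<close>, followed by completing the
    square in \<open>u - x\<close>.\<close>
  have bound: "\<gamma> * (r a + w \<bullet> (x - a)) - \<gamma>\<^sup>2 * (norm w)\<^sup>2 / 2 \<le> \<phi> u" if "u \<in> ?D" for u
  proof -
    have "r a + w \<bullet> (u - a) \<le> r u"
      using subdiff_real[OF f w that] by (simp add: r_def)
    then have "\<gamma> * (r a + w \<bullet> (u - a)) \<le> \<gamma> * r u"
      using \<gamma> by simp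
    moreover have "0 \<le> (norm (\<gamma> *\<^sub>R w + (u - x)))\<^sup>2"
      by simp
    ultimately show ?thesis
      unfolding \<phi>_def power2_norm_eq_inner
      by (simp add: algebra_simps inner_commute power2_eq_square)
  qed
  define m where "m = Inf (\<phi> ` ?D)"
  have bdd: "bdd_below (\<phi> ` ?D)"
    using bound by (intro bdd_belowI) auto
  have m_le: "m \<le> \<phi> u" if "u \<in> ?D" for u
    unfolding m_def using bdd that by (intro cInf_lower) auto
  have "\<exists>u\<in>?D. \<phi> u < m + 1 / real (Suc n)" for n
  proof -
    have "Inf (\<phi> ` ?D) < m + 1 / real (Suc n)"
      by (simp add: m_def)
    then show ?thesis
      using cInf_lessD[of "\<phi> ` ?D"] aD by blast
  qed
  then obtain q where qD: "\<And>n. q n \<in> ?D" and q: "\<And>n. \<phi> (q n) < m + 1 / real (Suc n)"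
    by metis
  \<comment> \<open>Compares \<open>m\<close> with the value at the midpoint \<open>c\<close>, where
    the parallelogram law gains an eighth of the squared distance.\<close>
  have strong: "(norm (u - v))\<^sup>2 \<le> 4 * (\<phi> u + \<phi> v - 2 * m)" if u: "u \<in> ?D" and v: "v \<in> ?D" for u v
  proof -
    define c where "c = (1 - 1 / 2) *\<^sub>R u + (1 / 2 :: real) *\<^sub>R v"
    have cD: "c \<in> ?D"
      using conv u v unfolding c_def by (intro convexD_alt convex_on_imp_convex) auto
    have rc: "r c \<le> (1 - 1 / 2) * r u + 1 / 2 * r v"
      unfolding c_def using conv u v by (intro convex_onD) auto
    have "\<gamma> * r c \<le> \<gamma> * ((1 - 1 / 2) * r u + 1 / 2 * r v)"
      using rc \<gamma> by (intro mult_left_mono) auto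
    moreover have "(norm (c - x))\<^sup>2 = (norm (u - x))\<^sup>2 / 2 + (norm (v - x))\<^sup>2 / 2 - (norm (u - v))\<^sup>2 / 4"
      unfolding c_def power2_norm_eq_inner
      by (simp add: algebra_simps inner_commute add_divide_distrib diff_divide_distrib)
    ultimately have "\<phi> c \<le> (\<phi> u + \<phi> v) / 2 - (norm (u - v))\<^sup>2 / 8"
      unfolding \<phi>_def by (simp add: algebra_simps)
    then show ?thesis
      using m_le[OF cD] by (simp add: field_simps)
  qed
  have "Cauchy q"
  proof (rule metric_CauchyI)
    fix e :: real assume e: "e > 0"
    \<comment> \<open>Two excesses below \<open>e\<^sup>2 / 8\<close> add up to less than
      \<open>e\<^sup>2 / 4\<close>, which the factor 4 in \<open>strong\<close> turns into
      \<open>e\<^sup>2\<close>.\<close>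
    obtain N where N: "inverse (real (Suc N)) < e\<^sup>2 / 8"
      using reals_Archimedean[of "e\<^sup>2 / 8"] e by auto
    have "dist (q i) (q j) < e" if "i \<ge> N" "j \<ge> N" for i j
    proof -
      have "1 / real (Suc i) \<le> 1 / real (Suc N)" "1 / real (Suc j) \<le> 1 / real (Suc N)"
        using that by (auto intro!: divide_left_mono)
      then have "\<phi> (q i) + \<phi> (q j) - 2 * m < e\<^sup>2 / 4"
        using q[of i] q[of j] N unfolding inverse_eq_divide by linarith
      then have "(norm (q i - q j))\<^sup>2 < e\<^sup>2"
        using strong[OF qD qD, of i j] by (simp add: field_simps)
      then show ?thesis
        using e by (auto simp: dist_norm intro: power2_less_imp_less)
    qed
    then show "\<exists>M. \<forall>i\<ge>M. \<forall>j\<ge>M. dist (q i) (q j) < e"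
      by blast
  qed
  then obtain p where p: "q \<longlonglongrightarrow> p"
    by (auto simp: Cauchy_convergent_iff convergent_def)
  \<comment> \<open>Lower semicontinuity is applied to \<open>f\<close> alone: the bound on
    \<open>\<phi> (q n)\<close> is solved for \<open>f (q n)\<close>, and the quadratic part
    converges by continuity.\<close>
  have "f p \<le> ereal ((m - 1 / 2 * (norm (p - x))\<^sup>2) / \<gamma>)"
  proof (rule lsc_fun_le_limit[OF _ p])
    show "lsc_fun f"
      using f by (simp add: Gamma0_def)
    show "f (q n) \<le> ereal ((m + 1 / real (Suc n) - 1 / 2 * (norm (q n - x))\<^sup>2) / \<gamma>)" for n
      using q[of n] unfolding fr[OF qD] \<phi>_def
      by (simp add: pos_le_divide_eq[OF \<gamma>] mult.commute[of _ \<gamma>] del: of_nat_Suc)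
    have "(\<lambda>n. 1 / real (Suc n)) \<longlonglongrightarrow> 0"
      using LIMSEQ_inverse_real_of_nat by (simp add: inverse_eq_divide)
    then have "(\<lambda>n. (m + 1 / real (Suc n) - 1 / 2 * (norm (q n - x))\<^sup>2) / \<gamma>)
        \<longlonglongrightarrow> (m + 0 - 1 / 2 * (norm (p - x))\<^sup>2) / \<gamma>"
      using p \<gamma> by (intro tendsto_intros) auto
    then show "(\<lambda>n. (m + 1 / real (Suc n) - 1 / 2 * (norm (q n - x))\<^sup>2) / \<gamma>)
        \<longlonglongrightarrow> (m - 1 / 2 * (norm (p - x))\<^sup>2) / \<gamma>"
      by simp
  qed
  moreover from this have pD: "p \<in> ?D"
    by (auto simp: dom_fun_def intro: le_less_trans)
  ultimately have "\<phi> p \<le> m"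
    using \<gamma> unfolding fr[OF pD] \<phi>_def by (simp add: field_simps)
  have "ereal \<gamma> * f p + ereal (1 / 2 * (norm (p - x))\<^sup>2)
      \<le> ereal \<gamma> * f u + ereal (1 / 2 * (norm (u - x))\<^sup>2)" for u
  proof (cases "u \<in> ?D")
    case True
    then show ?thesis
      using m_le[OF True] \<open>\<phi> p \<le> m\<close> by (simp add: fr pD \<phi>_def)
  next
    case False
    then show ?thesis
      using \<gamma> by (simp add: dom_fun_def)
  qed
  then show ?thesis
    by (auto simp: is_arg_min_linorder)
qed

text \<open>Let \<open>t\<close> decrease to 0. This discards the second-order term in the
  optimality condition of the proximal problem.\<close>

lemma nonpos_if_le_small_multiples:
  fixes A B :: real
  assumes "\<And>t. 0 < t \<Longrightarrow> t < 1 \<Longrightarrow> A \<le> t * B"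
  shows "A \<le> 0"
proof (rule tendsto_lowerbound)
  show "((\<lambda>t. t * B) \<longlongrightarrow> 0) (at_right 0)"
    by (auto intro!: tendsto_eq_intros)
  show "\<forall>\<^sub>F t in at_right 0. A \<le> t * B"
    using eventually_at_right_real[OF zero_less_one] by eventually_elim (use assms in auto)
qed simp

text \<open>The minimizer is compared with points of the segment towards \<open>y\<close>; the
  inequality is divided by the weight \<open>t\<close>, and \<open>t\<close> tends to 0. The
  subgradient \<open>w\<close> enters through the existence and finiteness of the minimum.\<close>

lemma prox_subdiff:
  fixes f :: "'a::{real_inner, complete_space} \<Rightarrow> ereal"
  assumes f: "f \<in> Gamma0" and w: "w \<in> subdiff f a" and \<gamma>: "\<gamma> > 0"
  shows "(1 / \<gamma>) *\<^sub>R (x - prox \<gamma> f x) \<in> subdiff f (prox \<gamma> f x)"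
proof -
  define p where "p = prox \<gamma> f x"
  let ?D = "dom_fun f"
  have min: "ereal \<gamma> * f p + ereal (1 / 2 * (norm (p - x))\<^sup>2)
      \<le> ereal \<gamma> * f y + ereal (1 / 2 * (norm (y - x))\<^sup>2)" for y
    using someI_ex[OF prox_exists[OF assms, of x]]
    by (simp add: p_def prox_def arg_min_def is_arg_min_linorder)
  have aD: "a \<in> ?D"
    using f w by (rule subdiff_dom)
  define r where "r u = real_of_ereal (f u)" for u
  have fr: "f u = ereal (r u)" if "u \<in> ?D" for u
    using Gamma0_real[OF f that] by (simp add: r_def)
  have pD: "p \<in> ?D"
  proof (rule ccontr)
    assume "p \<notin> ?D"
    then show False
      using min[of a] \<gamma> by (simp add: fr[OF aD] dom_fun_def)
  qed
  have conv: "convex_on ?D r"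
    using Gamma0_convex_on[OF f] by (simp add: r_def[abs_def])
  have "r p + (1 / \<gamma>) *\<^sub>R (x - p) \<bullet> (y - p) \<le> r y" if y: "y \<in> ?D" for y
  proof -
    have "\<gamma> * (r p - r y) + (x - p) \<bullet> (y - p) \<le> t * ((norm (y - p))\<^sup>2 / 2)" if t: "0 < t" "t < 1" for t
    proof -
      define c where "c = (1 - t) *\<^sub>R p + t *\<^sub>R y"
      have cD: "c \<in> ?D"
        using conv y pD t unfolding c_def by (intro convexD_alt convex_on_imp_convex) auto
      have "\<gamma> * r p + 1 / 2 * (norm (p - x))\<^sup>2 \<le> \<gamma> * r c + 1 / 2 * (norm (c - x))\<^sup>2"
        using min[of c] by (simp add: fr pD cD)
      moreover have "\<gamma> * r c \<le> \<gamma> * ((1 - t) * r p + t * r y)"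
        unfolding c_def using conv y pD t \<gamma> by (intro mult_left_mono convex_onD) auto
      moreover have "(norm (c - x))\<^sup>2 = (norm (p - x))\<^sup>2 - 2 * t * ((x - p) \<bullet> (y - p)) + t\<^sup>2 * (norm (y - p))\<^sup>2"
        unfolding c_def power2_norm_eq_inner
        by (simp add: algebra_simps inner_commute power2_eq_square)
      ultimately have "t * (\<gamma> * (r p - r y) + (x - p) \<bullet> (y - p)) \<le> t * (t * ((norm (y - p))\<^sup>2 / 2))"
        by (simp add: algebra_simps power2_eq_square)
      then show ?thesis
        using t by simp
    qed
    then have "\<gamma> * (r p - r y) + (x - p) \<bullet> (y - p) \<le> 0"
      by (rule nonpos_if_le_small_multiples)
    then have "(x - p) \<bullet> (y - p) / \<gamma> \<le> r y - r p"
      using \<gamma> unfolding pos_divide_le_eq[OF \<gamma>] by (simp add: algebra_simps)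
    then show ?thesis
      unfolding inner_scaleR_left by simp
  qed
  then have "f p + ereal ((1 / \<gamma>) *\<^sub>R (x - p) \<bullet> (y - p)) \<le> f y" for y
    by (cases "y \<in> ?D") (simp_all add: fr pD, simp add: dom_fun_def)
  then show ?thesis
    by (simp add: subdiff_def p_def)
qed

lemma ind_fun_Gamma0:
  assumes "convex V" and "closed V" and "V \<noteq> {}"
  shows "ind_fun V \<in> Gamma0"
proof -
  have "ind_fun V x \<le> Liminf (nhds x) (ind_fun V)" for x
  proof (cases "x \<in> V")
    case True
    then show ?thesis
      by (auto simp: ind_fun_def intro!: Liminf_bounded always_eventually)
  next
    case False
    then have "\<forall>\<^sub>F y in nhds x. y \<in> - V"
      using assms by (intro eventually_nhds_in_open) auto
    then have "\<forall>\<^sub>F y in nhds x. ind_fun V x \<le> ind_fun V y"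
      by eventually_elim (auto simp: ind_fun_def)
    then show ?thesis
      by (rule Liminf_bounded)
  qed
  moreover have "convex_fun (ind_fun V)"
    using assms by (auto simp: convex_fun_def ind_fun_def convex_alt)
  moreover have "proper_fun (ind_fun V)"
    using assms by (auto simp: proper_fun_def dom_fun_def ind_fun_def)
  ultimately show ?thesis
    by (simp add: Gamma0_def lsc_fun_def)
qed

lemma orthogonal_compD: "b \<in> orthogonal_comp V \<Longrightarrow> a \<in> V \<Longrightarrow> a \<bullet> b = 0"
  by (auto simp: orthogonal_comp_def orthogonal_def)

lemma orthogonal_decomp_unique:
  assumes "subspace V" and "p \<in> V" and "q \<in> V"
    and "x - p \<in> orthogonal_comp V" and "x - q \<in> orthogonal_comp V"
  shows "p = q"
proof -
  have "p - q \<in> V"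
    using assms by (simp add: subspace_diff)
  then have "(p - q) \<bullet> (x - p) = 0" "(p - q) \<bullet> (x - q) = 0"
    using assms orthogonal_compD by auto
  then have "(p - q) \<bullet> (p - q) = 0"
    by (simp add: algebra_simps)
  then show ?thesis
    by simp
qed

lemma proj_eqI:
  assumes "subspace V" and "p \<in> V" and "x - p \<in> orthogonal_comp V"
  shows "proj V x = p"
  unfolding proj_def using assms orthogonal_decomp_unique by blast

text \<open>The projection of \<open>x\<close> is found as the proximal point of the indicator function.\<close>
lemma proj_props:
  fixes V :: "'a::{real_inner, complete_space} set"
  assumes V: "subspace V" "closed V"
  shows "proj V x \<in> V" and "x - proj V x \<in> orthogonal_comp V"
proof -
  define p where "p = prox 1 (ind_fun V) x"
  have V0: "0 \<in> V"
    using V by (simp add: subspace_0)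
  have \<Gamma>: "ind_fun V \<in> Gamma0"
    using V V0 by (intro ind_fun_Gamma0) (auto simp: subspace_imp_convex)
  have "0 \<in> subdiff (ind_fun V) 0"
    using V0 by (auto simp: subdiff_def ind_fun_def)
  then have sub: "x - p \<in> subdiff (ind_fun V) p"
    using prox_subdiff[OF \<Gamma>, of 0 0 1 x] by (simp add: p_def)
  have pV: "p \<in> V"
    using subdiff_dom[OF \<Gamma> sub] by (auto simp: dom_fun_def ind_fun_def split: if_splits)
  have le: "(x - p) \<bullet> (y - p) \<le> 0" if "y \<in> V" for y
  proof -
    have "ind_fun V p + ereal ((x - p) \<bullet> (y - p)) \<le> ind_fun V y"
      using sub by (auto simp: subdiff_def)
    then show ?thesis
      using pV that by (simp add: ind_fun_def zero_ereal_def)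
  qed
  have "y \<bullet> (x - p) = 0" if "y \<in> V" for y
  proof -
    \<comment> \<open>Testing with both signs turns the variational inequality into
      orthogonality.\<close>
    have "p + y \<in> V" "p - y \<in> V"
      using V pV that by (auto simp: subspace_add subspace_diff)
    from le[OF this(1)] le[OF this(2)] show ?thesis
      by (simp add: inner_commute)
  qed
  then have perp: "x - p \<in> orthogonal_comp V"
    by (auto simp: orthogonal_comp_def orthogonal_def)
  have "proj V x = p"
    using V(1) pV perp by (rule proj_eqI)
  then show "proj V x \<in> V" "x - proj V x \<in> orthogonal_comp V"
    using pV perp by auto
qed

lemma norm_proj_le:
  fixes V :: "'a::{real_inner, complete_space} set"
  assumes V: "subspace V" "closed V"
  shows "norm (proj V x) \<le> norm x"
proof -
  have "proj V x \<bullet> (x - proj V x) = 0"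
    using proj_props[OF V, of x] orthogonal_compD by blast
  then have "x \<bullet> x = proj V x \<bullet> proj V x + (x - proj V x) \<bullet> (x - proj V x)"
    by (simp add: algebra_simps inner_commute)
  then show ?thesis
    by (simp add: norm_le)
qed

lemma bounded_linear_proj:
  fixes V :: "'a::{real_inner, complete_space} set"
  assumes V: "subspace V" "closed V"
  shows "bounded_linear (proj V)"
proof (rule bounded_linear_intro[of _ 1])
  note P = proj_props[OF V]
  note sO = subspace_orthogonal_comp
  show "proj V (x + y) = proj V x + proj V y" for x y
  proof (rule proj_eqI[OF V(1)])
    have "x - proj V x + (y - proj V y) \<in> orthogonal_comp V"
      using P sO by (intro subspace_add) auto
    then show "x + y - (proj V x + proj V y) \<in> orthogonal_comp V"
      by (simp add: algebra_simps)
  qed (use P V in \<open>auto simp: subspace_add\<close>)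
  show "proj V (c *\<^sub>R x) = c *\<^sub>R proj V x" for c x
  proof (rule proj_eqI[OF V(1)])
    have "c *\<^sub>R (x - proj V x) \<in> orthogonal_comp V"
      using P sO by (intro subspace_scale) auto
    then show "c *\<^sub>R x - c *\<^sub>R proj V x \<in> orthogonal_comp V"
      by (simp add: algebra_simps)
  qed (use P V in \<open>auto simp: subspace_scale\<close>)
  show "norm (proj V x) \<le> norm x * 1" for x
    using norm_proj_le[OF V] by simp
qed

subsection \<open>Convex functions with Lipschitz gradient\<close>

lemma grad_eqI:
  assumes "GDERIV f x :> D"
  shows "grad f x = D"
  unfolding grad_def
proof (rule the_equality)
  fix D' assume "GDERIV f x :> D'"
  then have "(\<lambda>h. h \<bullet> D') = (\<lambda>h. h \<bullet> D)"
    using assms has_derivative_unique unfolding gderiv_def by blast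
  then have "(D' - D) \<bullet> D' = (D' - D) \<bullet> D"
    by meson
  then have "(D' - D) \<bullet> (D' - D) = 0"
    by (simp add: inner_diff_right)
  then show "D' = D"
    by simp
qed (rule assms)

text \<open>Chain rule, then self-adjointness of \<open>proj V\<close>, which moves the projector
  from the direction \<open>h\<close> onto \<open>D\<close>. In particular the gradient of the
  composition lies in \<open>V\<close>.\<close>

lemma GDERIV_comp_proj:
  fixes V :: "'a::{real_inner, complete_space} set"
  assumes V: "subspace V" "closed V" and F: "GDERIV F (proj V x) :> D"
  shows "GDERIV (F \<circ> proj V) x :> proj V D"
proof -
  have "(F \<circ> proj V has_derivative (\<lambda>h. h \<bullet> D) \<circ> proj V) (at x)"
    using F bounded_linear.has_derivative[OF bounded_linear_proj[OF V] has_derivative_ident]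
    by (intro diff_chain_at) (auto simp: gderiv_def)
  moreover have "proj V h \<bullet> D = h \<bullet> proj V D" for h
  proof -
    have "proj V h \<bullet> (D - proj V D) = 0" "proj V D \<bullet> (h - proj V h) = 0"
      using proj_props[OF V] orthogonal_compD by blast+
    then show ?thesis
      by (simp add: algebra_simps inner_commute)
  qed
  ultimately show ?thesis
    by (simp add: gderiv_def o_def)
qed

lemma convex_on_comp_proj:
  fixes V :: "'a::{real_inner, complete_space} set"
  assumes V: "subspace V" "closed V" and F: "convex_on UNIV F"
  shows "convex_on UNIV (F \<circ> proj V)"
proof (rule convex_onI)
  interpret P: bounded_linear "proj V"
    using V by (rule bounded_linear_proj)
  show "(F \<circ> proj V) ((1 - t) *\<^sub>R x + t *\<^sub>R y) \<le> (1 - t) * (F \<circ> proj V) x + t * (F \<circ> proj V) y"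
    if "t > 0" "t < 1" for t x y
    using that F by (simp add: P.add P.scaleR convex_onD)
qed simp

lemma DERIV_along_line:
  assumes "GDERIV f (x + t *\<^sub>R d) :> D"
  shows "((\<lambda>t. f (x + t *\<^sub>R d)) has_real_derivative D \<bullet> d) (at t)"
proof -
  have line: "((\<lambda>t. x + t *\<^sub>R d) has_derivative (\<lambda>s. s *\<^sub>R d)) (at t)"
    by (auto intro!: derivative_eq_intros)
  have "((\<lambda>t. f (x + t *\<^sub>R d)) has_derivative (\<lambda>s. (s *\<^sub>R d) \<bullet> D)) (at t)"
    using has_derivative_compose[OF line] assms unfolding gderiv_def by blast
  moreover have "(\<lambda>s. (s *\<^sub>R d) \<bullet> D) = (*) (D \<bullet> d)"
    by (simp add: fun_eq_iff inner_commute[of d D])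
  ultimately show ?thesis
    by (simp add: has_field_derivative_def)
qed

text \<open>On the line through \<open>x\<close> and \<open>y\<close> this is the tangent inequality
  for a convex function of one real variable.\<close>

lemma convex_gradient_ineq:
  fixes f :: "'a::real_inner \<Rightarrow> real"
  assumes f: "convex_on UNIV f" and D: "GDERIV f x :> D"
  shows "f x + D \<bullet> (y - x) \<le> f y"
proof -
  define \<phi> where "\<phi> t = f (x + t *\<^sub>R (y - x))" for t :: real
  have "convex_on UNIV \<phi>"
  proof (rule convex_onI)
    fix t a b :: real assume t: "0 < t" "t < 1"
    have eq: "x + ((1 - t) * a + t * b) *\<^sub>R (y - x)
        = (1 - t) *\<^sub>R (x + a *\<^sub>R (y - x)) + t *\<^sub>R (x + b *\<^sub>R (y - x))"
      by (simp add: algebra_simps)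
    show "\<phi> ((1 - t) *\<^sub>R a + t *\<^sub>R b) \<le> (1 - t) * \<phi> a + t * \<phi> b"
      using convex_onD[OF f, of t "x + a *\<^sub>R (y - x)" "x + b *\<^sub>R (y - x)"] t
      by (simp add: \<phi>_def eq)
  qed simp
  moreover have "(\<phi> has_real_derivative D \<bullet> (y - x)) (at 0)"
    unfolding \<phi>_def using D by (intro DERIV_along_line) simp
  ultimately have "\<phi> 1 - \<phi> 0 \<ge> D \<bullet> (y - x) * (1 - 0)"
    by (intro convex_on_imp_above_tangent[where A = UNIV]) auto
  then show ?thesis
    by (simp add: \<phi>_def)
qed

text \<open>Along the segment, \<open>\<psi>\<close> is \<open>f\<close> minus its linear term and
  the quadratic allowance. Cauchy-Schwarz and the Lipschitz bound make its derivative nonpositive,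
  so \<open>\<psi> 1 \<le> \<psi> 0\<close>.\<close>

lemma descent_lemma:
  fixes f :: "'a::real_inner \<Rightarrow> real"
  assumes D: "\<And>x. GDERIV f x :> g x" and L: "L-lipschitz_on UNIV g"
  shows "f y \<le> f x + g x \<bullet> (y - x) + L / 2 * (norm (y - x))\<^sup>2"
proof -
  define d where "d = y - x"
  define \<psi> where "\<psi> t = f (x + t *\<^sub>R d) - t * (g x \<bullet> d) - L / 2 * t\<^sup>2 * (norm d)\<^sup>2" for t
  have "\<psi> 0 \<ge> \<psi> 1"
  proof (rule DERIV_nonpos_imp_nonincreasing[of 0 1 \<psi>])
    fix t :: real assume t: "0 \<le> t" "t \<le> 1"
    have "((\<lambda>t. f (x + t *\<^sub>R d)) has_real_derivative g (x + t *\<^sub>R d) \<bullet> d) (at t)"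
      using D by (rule DERIV_along_line)
    then have "(\<psi> has_real_derivative g (x + t *\<^sub>R d) \<bullet> d - g x \<bullet> d - L * t * (norm d)\<^sup>2) (at t)"
      unfolding \<psi>_def by (auto intro!: derivative_eq_intros)
    moreover have "(g (x + t *\<^sub>R d) - g x) \<bullet> d \<le> L * t * (norm d)\<^sup>2"
    proof -
      have "(g (x + t *\<^sub>R d) - g x) \<bullet> d \<le> norm (g (x + t *\<^sub>R d) - g x) * norm d"
        by (rule norm_cauchy_schwarz)
      also have "\<dots> \<le> (L * (t * norm d)) * norm d"
        using lipschitz_onD[OF L, of "x + t *\<^sub>R d" x] t
        by (intro mult_right_mono) (auto simp: dist_norm)
      finally show ?thesis
        by (simp add: power2_eq_square algebra_simps)
    qed
    ultimately show "\<exists>y. (\<psi> has_real_derivative y) (at t) \<and> y \<le> 0"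
      by (intro exI conjI) (auto simp: inner_diff_left)
  qed simp
  then show ?thesis
    by (simp add: \<psi>_def d_def)
qed

text \<open>Cocoercivity of the gradient, obtained by adding \<open>half\<close> to itself with the
  two points exchanged.\<close>

lemma baillon_haddad:
  fixes f :: "'a::real_inner \<Rightarrow> real"
  assumes f: "convex_on UNIV f" and D: "\<And>x. GDERIV f x :> g x"
    and b: "b > 0" and L: "(1 / b)-lipschitz_on UNIV g"
  shows "b * (norm (g x - g y))\<^sup>2 \<le> (g x - g y) \<bullet> (x - y)"
proof -
  have half: "f p + g p \<bullet> (q - p) + b / 2 * (norm (g q - g p))\<^sup>2 \<le> f q" for p q
  proof -
    \<comment> \<open>This \<open>s\<close> minimizes the quadratic upper model of \<open>f\<close>
      at \<open>q\<close> minus the tangent of \<open>f\<close> at \<open>p\<close>, so the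
      comparison at \<open>s\<close> is the sharpest one.\<close>
    define s where "s = q - b *\<^sub>R (g q - g p)"
    have "f p + g p \<bullet> (s - p) \<le> f s"
      using f D by (rule convex_gradient_ineq)
    also have "f s \<le> f q + g q \<bullet> (s - q) + 1 / b / 2 * (norm (s - q))\<^sup>2"
      using D L by (rule descent_lemma)
    finally show ?thesis
      using b unfolding s_def power2_norm_eq_inner
      by (simp add: algebra_simps inner_commute)
  qed
  from half[of x y] half[of y x] show ?thesis
    by (simp add: algebra_simps norm_minus_commute)
qed

subsection \<open>Summability\<close>

text \<open>The differences of \<open>E\<close> telescope to at most \<open>E 0\<close>. It serves
  first for the squared steps, then for the divergences.\<close>

lemma summable_if_telescoping_bound:
  fixes a E e :: "nat \<Rightarrow> real"
  assumes a: "\<And>k. 0 \<le> a k" and E: "\<And>k. 0 \<le> E k" and e: "\<And>k. 0 \<le> e k" "summable e"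
    and step: "\<And>k. a k \<le> E k - E (Suc k) + e k"
  shows "summable a"
proof (rule summableI_nonneg_bounded)
  fix n
  have "(\<Sum>k<n. a k) \<le> E 0 - E n + (\<Sum>k<n. e k)"
  proof (induction n)
    case (Suc n)
    then show ?case
      using step[of n] by simp
  qed simp
  moreover have "(\<Sum>k<n. e k) \<le> suminf e"
    using e by (intro sum_le_suminf) auto
  ultimately show "(\<Sum>k<n. a k) \<le> E 0 + suminf e"
    using E[of n] by linarith
qed (rule a)

text \<open>The terms with index between \<open>k / 2\<close> and \<open>k\<close> already contribute
  at least \<open>(k + 1) / 2 * m k\<close> to a vanishing tail.\<close>
lemma antimono_summable_smallo:
  fixes m :: "nat \<Rightarrow> real"
  assumes anti: "antimono m" and nonneg: "\<And>k. 0 \<le> m k" and sm: "summable m"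
  shows "m \<in> o(\<lambda>k. 1 / (real k + 1))"
proof -
  define T where "T n = suminf m - (\<Sum>i<n. m i)" for n
  have "T \<longlonglongrightarrow> suminf m - suminf m"
    unfolding T_def using summable_LIMSEQ[OF sm] by (intro tendsto_intros)
  moreover have "filterlim (\<lambda>k::nat. k div 2) at_top at_top"
    by (rule filterlim_at_top_div_const_nat) simp
  ultimately have "(\<lambda>k. T (k div 2)) \<longlonglongrightarrow> 0"
    by (auto intro: filterlim_compose)
  then have lim: "(\<lambda>k. 2 * T (k div 2)) \<longlonglongrightarrow> 0"
    by (rule tendsto_mult_right_zero)
  have le: "m k * (real k + 1) \<le> 2 * T (k div 2)" for k
  proof -
    have "real k + 1 \<le> 2 * real (card {k div 2..<Suc k})"
      by simp
    then have "m k * (real k + 1) \<le> m k * (2 * real (card {k div 2..<Suc k}))"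
      using nonneg by (rule mult_left_mono)
    also have "\<dots> = 2 * (\<Sum>i\<in>{k div 2..<Suc k}. m k)"
      by simp
    also have "\<dots> \<le> 2 * (\<Sum>i\<in>{k div 2..<Suc k}. m i)"
      by (intro mult_left_mono sum_mono) (use anti in \<open>auto simp: antimono_def\<close>)
    also have "(\<Sum>i\<in>{k div 2..<Suc k}. m i) = (\<Sum>i<Suc k. m i) - (\<Sum>i<k div 2. m i)"
      by (simp add: lessThan_atLeast0 sum_diff_nat_ivl del: sum.op_ivl_Suc)
    also have "(\<Sum>i<Suc k. m i) \<le> suminf m"
      using nonneg sm by (intro sum_le_suminf) auto
    finally show ?thesis
      by (simp add: T_def)
  qed
  have "(\<lambda>k. m k * (real k + 1)) \<longlonglongrightarrow> 0"
    using nonneg le by (intro tendsto_sandwich[OF _ _ tendsto_const lim]) (auto intro!: always_eventually)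
  then show ?thesis
    by (intro smalloI_tendsto) (auto simp: field_simps intro!: always_eventually)
qed

subsection \<open>The Forward-Douglas-Rachford iteration\<close>

text \<open>Orthogonality amounts to \<open>y \<bullet> y = y \<bullet> (b - h)\<close>; with it the
  left side collapses to \<open>- 2 * (b \<bullet> h)\<close>, and polarization gives the squares.
  In the iteration, \<open>z' - z + x\<close> is the new \<open>u\<close>.\<close>

lemma FDR_step_identity:
  fixes x :: "'a::real_inner"
  assumes "(x - xs) \<bullet> (z - x) = 0" and "(x - xs) \<bullet> v = 0"
  shows "2 * ((x - z' - v) \<bullet> (z' - z + x - xs))
    = (norm (z - xs + v))\<^sup>2 - (norm (z' - xs + v))\<^sup>2 - (norm (z' - z))\<^sup>2"
proof -
  define b where "b = z' - xs + v"
  define h where "h = z' - z"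
  define y where "y = x - xs"
  have yy: "y \<bullet> y = y \<bullet> (b - h)"
    using assms unfolding y_def b_def h_def by (simp add: algebra_simps inner_commute)
  have eqs: "z' - z = h" "h + x - xs = h + y" "x - z' - v = y - b" "z - xs + v = b - h" "z' - xs + v = b"
    unfolding y_def b_def h_def by (simp_all add: algebra_simps)
  show ?thesis
    unfolding eqs power2_norm_eq_inner using yy by (simp add: inner_simps inner_commute)
qed

theorem theorem3p6:
  fixes R :: "'a::{real_inner, complete_space} \<Rightarrow> ereal"
    and F G :: "'a \<Rightarrow> real"
    and V :: "'a set"
    and \<Phi> \<Phi>V :: "'a \<Rightarrow> ereal"
    and \<beta> \<beta>V \<gamma>min \<gamma>max \<gamma>lim :: real
    and \<gamma> relax :: "nat \<Rightarrow> real"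
    and u z x ubar :: "nat \<Rightarrow> 'a"
    and zs xs vs :: 'a
  assumes R: "R \<in> Gamma0"
    and F_convex: "convex_on UNIV F"
    and F_diff: "\<And>y. \<exists>D. GDERIV F y :> D"
    and F_C1: "continuous_on UNIV (grad F)"
    and \<beta>_pos: "\<beta> > 0"
    and F_lipschitz: "(1 / \<beta>)-lipschitz_on UNIV (grad F)"
    and V: "subspace V" "closed V"
    and G_def: "G = F \<circ> proj V"
    and \<beta>V: "\<beta>V \<ge> \<beta>"
    and G_lipschitz: "(1 / \<beta>V)-lipschitz_on UNIV (grad G)"
    and \<Phi>V_def: "\<Phi>V = (\<lambda>y. ereal (G y) + R y + ind_fun V y)"
    and Argmin_ne: "Argmin \<Phi>V \<noteq> {}"
    and \<Phi>_def: "\<Phi> = (\<lambda>y. R y + ereal (G y))"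
    and \<gamma>min_pos: "0 < \<gamma>min"
    and \<gamma>_bounds: "\<And>k. \<gamma>min \<le> \<gamma> k" "\<And>k. \<gamma> k \<le> \<gamma>max"
    and \<gamma>max: "\<gamma>max < 2 * \<beta>V"
    and \<gamma>_lim: "\<gamma> \<longlonglongrightarrow> \<gamma>lim" "\<gamma>lim \<in> {\<gamma>min..\<gamma>max}"
    and relax_one: "\<And>k. relax k = 1"
    and relax_bounds: "\<And>k. relax k \<in> {0 <..< (4 * \<beta>V - \<gamma> k) / (2 * \<beta>V)}"
    and relax_div: "filterlim
          (\<lambda>n. \<Sum>k<n. relax k * ((4 * \<beta>V - \<gamma> k) / (2 * \<beta>V) - relax k)) at_top sequentially"
    and \<gamma>_summable: "summable (\<lambda>k. relax k * \<bar>\<gamma> k - \<gamma>lim\<bar>)"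
    and u0: "u 0 \<in> dom_fun R"
    and x0: "x 0 = proj V (z 0)"
    and u_step: "\<And>k. u (Suc k) =
          prox (\<gamma> k) R (2 *\<^sub>R x k - z k - \<gamma> k *\<^sub>R grad G (x k))"
    and z_step: "\<And>k. z (Suc k) = z k + u (Suc k) - x k"
    and x_step: "\<And>k. x (Suc k) = proj V (z (Suc k))"
    and zs: "zs \<in> fixpts (FDR_op \<gamma>lim R V G)"
    and xs: "xs = proj V zs" "xs \<in> Argmin \<Phi>V"
    and vs: "vs \<in> orthogonal_comp V \<inter> {w + grad G xs | w. w \<in> subdiff R xs}"
    and vs_bounded: "ereal (norm vs) < \<infinity>"
    and ubar_def: "\<And>k. ubar k = (1 / (real k + 1)) *\<^sub>R (\<Sum>i=0..k. u i)"
  shows "(\<forall>k. \<bar>INF i\<in>{0..k}. bregman \<Phi> xs vs (u i)\<bar> \<noteq> \<infinity>)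
       \<and> (\<lambda>k. real_of_ereal (INF i\<in>{0..k}. bregman \<Phi> xs vs (u i)))
           \<in> o(\<lambda>k. 1 / (real k + 1))
       \<and> (\<forall>k. \<bar>bregman \<Phi> xs vs (ubar k)\<bar> \<noteq> \<infinity>)
       \<and> (\<lambda>k. real_of_ereal (bregman \<Phi> xs vs (ubar k)))
           \<in> O(\<lambda>k. 1 / (real k + 1))"
proof -

  \<comment> \<open>Optimality conditions and orthogonality of the iterates\<close>
  let ?D = "dom_fun R"
  define g where "g = grad G"
  have GD: "GDERIV G y :> g y" and gV: "g y \<in> V" for y
  proof -
    obtain D where "GDERIV F (proj V y) :> D"
      using F_diff by blast
    then have "GDERIV G y :> proj V D"
      unfolding G_def by (rule GDERIV_comp_proj[OF V])
    then show "GDERIV G y :> g y" "g y \<in> V"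
      using grad_eqI[of G y "proj V D"] proj_props(1)[OF V] by (auto simp: g_def)
  qed
  have G_convex: "convex_on UNIV G"
    unfolding G_def using V F_convex by (rule convex_on_comp_proj)
  have G_lip: "(1 / \<beta>V)-lipschitz_on UNIV g"
    using G_lipschitz by (simp add: g_def)
  have \<beta>V_pos: "\<beta>V > 0"
    using \<beta>_pos \<beta>V by linarith
  have \<gamma>_pos: "\<gamma> k > 0" for k
    using \<gamma>min_pos \<gamma>_bounds(1)[of k] by linarith
  obtain w where w: "w \<in> subdiff R xs" and vs_eq: "vs = w + g xs"
    using vs by (auto simp: g_def)
  have vs_perp: "a \<bullet> vs = 0" if "a \<in> V" for a
    using vs that orthogonal_compD by blast
  have xsV: "xs \<in> V"
    using proj_props(1)[OF V] xs(1) by simp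
  have xsD: "xs \<in> ?D"
    using R w by (rule subdiff_dom)
  have x_eq: "x k = proj V (z k)" for k
    using x0 x_step by (cases k) auto
  have xV: "x k \<in> V" and zx: "z k - x k \<in> orthogonal_comp V" for k
    unfolding x_eq using proj_props[OF V] by auto
  have u_eq: "u (Suc k) = z (Suc k) - z k + x k" for k
    using z_step[of k] by simp
  \<comment> \<open>The vector \<open>u (Suc k) - x (Suc k)\<close> is the difference of the
    components of \<open>z (Suc k)\<close> and \<open>z k\<close> orthogonal to
    \<open>V\<close>.\<close>
  have ux: "a \<bullet> (u (Suc k) - x (Suc k)) = 0" if "a \<in> V" for a k
    using orthogonal_compD[OF zx[of k] that] orthogonal_compD[OF zx[of "Suc k"] that]
    unfolding u_eq by (simp add: inner_simps)
  \<comment> \<open>Optimality condition of the proximal step, with \<open>u (Suc k)\<close>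
    eliminated from the residual.\<close>
  have sub: "(1 / \<gamma> k) *\<^sub>R (x k - z (Suc k) - \<gamma> k *\<^sub>R g (x k)) \<in> subdiff R (u (Suc k))" for k
  proof -
    have eq: "2 *\<^sub>R x k - z k - \<gamma> k *\<^sub>R g (x k) - u (Suc k) = x k - z (Suc k) - \<gamma> k *\<^sub>R g (x k)"
      unfolding u_eq by (simp add: algebra_simps scaleR_2)
    show ?thesis
      using prox_subdiff[OF R w \<gamma>_pos[of k], of "2 *\<^sub>R x k - z k - \<gamma> k *\<^sub>R g (x k)"]
      unfolding u_step[of k, folded g_def, symmetric] eq .
  qed
  have uD: "u k \<in> ?D" for k
    using u0 subdiff_dom[OF R sub] by (cases k) auto

  \<comment> \<open>The divergence on the domain of \<open>R\<close> and the energy identity of one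
    step\<close>
  define r where "r y = real_of_ereal (R y)" for y
  have Rr: "R y = ereal (r y)" if "y \<in> ?D" for y
    using Gamma0_real[OF R that] by (simp add: r_def)
  define B where "B y = r y + G y - r xs - G xs - vs \<bullet> (y - xs)" for y
  have breg: "bregman \<Phi> xs vs y = ereal (B y)" if "y \<in> ?D" for y
    unfolding bregman_def \<Phi>_def B_def by (simp add: Rr that xsD)
  \<comment> \<open>As \<open>vs = w + g xs\<close>, the divergence is the sum of the subgradient
    gaps of \<open>R\<close> and \<open>G\<close> at \<open>xs\<close>.\<close>
  have B_nonneg: "0 \<le> B y" if "y \<in> ?D" for y
    using subdiff_real[OF R w that] convex_gradient_ineq[OF G_convex GD, of xs y]
    unfolding B_def vs_eq r_def by (simp add: inner_simps)
  have r_convex: "convex_on ?D r"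
    using Gamma0_convex_on[OF R] by (simp add: r_def[abs_def])
  have B_convex: "convex_on ?D B"
  proof (rule convex_onI)
    fix t :: real and a b assume ab: "0 < t" "t < 1" "a \<in> ?D" "b \<in> ?D"
    have "vs \<bullet> ((1 - t) *\<^sub>R a + t *\<^sub>R b - xs) = (1 - t) * (vs \<bullet> (a - xs)) + t * (vs \<bullet> (b - xs))"
      by (simp add: algebra_simps)
    then show "B ((1 - t) *\<^sub>R a + t *\<^sub>R b) \<le> (1 - t) * B a + t * B b"
      using convex_onD[OF r_convex, of t a b] convex_onD[OF G_convex, of t a b] ab
      unfolding B_def by (simp add: algebra_simps)
  qed (rule convex_on_imp_convex[OF r_convex])

  \<comment> \<open>The anchor \<open>xs - \<gamma>lim *\<^sub>R vs\<close> projects onto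
    \<open>xs\<close> and is a fixed point of \<open>FDR_op \<gamma>lim R V G\<close>, so
    \<open>E\<close> is a squared distance to a solution.\<close>
  define E where "E k = (norm (z k - xs + \<gamma>lim *\<^sub>R vs))\<^sup>2" for k
  define s where "s k = (norm (z (Suc k) - z k))\<^sup>2" for k
  define \<delta> where "\<delta> k = \<gamma> k - \<gamma>lim" for k
  define q where "q k = (z (Suc k) - z k) \<bullet> vs" for k
  define P where "P k = (x k - z (Suc k) - \<gamma> k *\<^sub>R vs) \<bullet> (u (Suc k) - xs)" for k
  have s_nonneg: "0 \<le> s k" for k
    by (simp add: s_def)
  have dx: "(norm (x (Suc k) - x k))\<^sup>2 \<le> s k" for k
  proof -
    interpret P: bounded_linear "proj V"
      using V by (rule bounded_linear_proj)
    show ?thesis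
      unfolding s_def x_eq P.diff[symmetric] by (intro power_mono norm_proj_le[OF V]) auto
  qed
  text \<open>The quadratic terms in \<open>\<delta> k\<close> cancel when the anchor \<open>xs - \<gamma> k *\<^sub>R vs\<close> of the
    step is replaced by the limiting one.\<close>
  have P_eq: "2 * P k = E k - E (Suc k) - s k - 2 * \<delta> k * q k" for k
  proof -
    have V': "x k - xs \<in> V"
      using V xV xsV by (simp add: subspace_diff)
    have "2 * P k = (norm (z k - xs + \<gamma> k *\<^sub>R vs))\<^sup>2 - (norm (z (Suc k) - xs + \<gamma> k *\<^sub>R vs))\<^sup>2 - s k"
      unfolding P_def s_def u_eq
      by (rule FDR_step_identity) (simp_all add: orthogonal_compD[OF zx V'] vs_perp[OF V'])
    moreover have shift: "(norm (b + \<gamma> k *\<^sub>R vs))\<^sup>2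
        = (norm (b + \<gamma>lim *\<^sub>R vs))\<^sup>2 + 2 * \<delta> k * (b \<bullet> vs) + ((\<gamma> k)\<^sup>2 - \<gamma>lim\<^sup>2) * (vs \<bullet> vs)" for b
      unfolding power2_norm_eq_inner \<delta>_def
      by (simp add: algebra_simps inner_commute power2_eq_square)
    ultimately show ?thesis
      unfolding shift E_def q_def by (simp add: algebra_simps)
  qed

  \<comment> \<open>Estimates of \<open>P\<close> from below and of the divergence from
    above\<close>
  have P_lower: "- (\<gamma> k / (2 * \<beta>V)) * s k \<le> 2 * P k" for k
  proof -
    define e where "e = g (x k) - g xs"
    define h where "h = x (Suc k) - x k"
    have eV: "e \<in> V"
      using V gV by (simp add: e_def subspace_diff)
    have "r (u (Suc k)) + ((1 / \<gamma> k) *\<^sub>R (x k - z (Suc k) - \<gamma> k *\<^sub>R g (x k))) \<bullet> (xs - u (Suc k)) \<le> r xs"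
      and "r xs + w \<bullet> (u (Suc k) - xs) \<le> r (u (Suc k))"
      using subdiff_real[OF R sub xsD, of k] subdiff_real[OF R w uD] by (simp_all add: r_def)
    then have "w \<bullet> (u (Suc k) - xs)
        \<le> (x k - z (Suc k) - \<gamma> k *\<^sub>R g (x k)) \<bullet> (u (Suc k) - xs) / \<gamma> k"
      unfolding inner_scaleR_left by (simp add: inner_diff_right diff_divide_distrib)
    then have "\<gamma> k * (w \<bullet> (u (Suc k) - xs)) \<le> (x k - z (Suc k) - \<gamma> k *\<^sub>R g (x k)) \<bullet> (u (Suc k) - xs)"
      unfolding pos_le_divide_eq[OF \<gamma>_pos] by (simp add: mult.commute)
    then have "\<gamma> k * (e \<bullet> (u (Suc k) - xs)) \<le> P k"
      unfolding P_def e_def vs_eq by (simp add: algebra_simps)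
    \<comment> \<open>Since \<open>e\<close> lies in \<open>V\<close>, \<open>u (Suc k)\<close> may
      be replaced by its projection \<open>x (Suc k)\<close>, which is
      \<open>x k + h\<close>.\<close>
    moreover have "e \<bullet> (u (Suc k) - xs) = e \<bullet> (x k - xs) + e \<bullet> h"
      using ux[OF eV, of k] by (simp add: h_def inner_simps)
    moreover have "\<beta>V * (norm e)\<^sup>2 \<le> e \<bullet> (x k - xs)"
      unfolding e_def using G_convex GD \<beta>V_pos G_lip by (rule baillon_haddad)
    moreover have "- (s k / (4 * \<beta>V)) \<le> \<beta>V * (norm e)\<^sup>2 + e \<bullet> h"
    proof -
      \<comment> \<open>The weight \<open>2 * \<beta>V\<close> makes the term in
        \<open>norm e\<close> match the whole cocoercivity gain.\<close>
      have "0 \<le> (norm ((2 * \<beta>V) *\<^sub>R e + h))\<^sup>2"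
        by simp
      also have "\<dots> = 4 * \<beta>V * (\<beta>V * (norm e)\<^sup>2 + e \<bullet> h) + (norm h)\<^sup>2"
        unfolding power2_norm_eq_inner by (simp add: algebra_simps inner_commute)
      finally have "- s k \<le> 4 * \<beta>V * (\<beta>V * (norm e)\<^sup>2 + e \<bullet> h)"
        using dx[of k] by (simp add: h_def)
      then show ?thesis
        using \<beta>V_pos by (simp add: field_simps)
    qed
    ultimately have "- (s k / (4 * \<beta>V)) \<le> e \<bullet> (u (Suc k) - xs)"
        and le: "\<gamma> k * (e \<bullet> (u (Suc k) - xs)) \<le> P k"
      by linarith+
    then have "\<gamma> k * - (s k / (4 * \<beta>V)) \<le> \<gamma> k * (e \<bullet> (u (Suc k) - xs))"
      using \<gamma>_pos[of k] by (intro mult_left_mono) auto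
    then show ?thesis
      using le by simp
  qed

  have B_upper: "\<gamma> k * B (u (Suc k)) \<le> P k + \<gamma> k / (2 * \<beta>V) * s k" for k
  proof -
    have "r (u (Suc k)) - r xs \<le> (x k - z (Suc k) - \<gamma> k *\<^sub>R g (x k)) \<bullet> (u (Suc k) - xs) / \<gamma> k"
      using subdiff_real[OF R sub xsD, of k] unfolding r_def inner_scaleR_left
      by (simp add: inner_diff_right diff_divide_distrib)
    then have "\<gamma> k * (r (u (Suc k)) - r xs)
        \<le> (x k - z (Suc k) - \<gamma> k *\<^sub>R g (x k)) \<bullet> (u (Suc k) - xs)"
      unfolding pos_le_divide_eq[OF \<gamma>_pos] by (simp add: mult.commute)
    moreover have "\<gamma> k * (G (u (Suc k)) - G xs)
        \<le> \<gamma> k * (g (x k) \<bullet> (u (Suc k) - xs) + s k / (2 * \<beta>V))"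
    proof (rule mult_left_mono)
      \<comment> \<open>\<open>G\<close> sees only the projection, so the descent lemma is applied
        between \<open>x k\<close> and \<open>x (Suc k)\<close>, whose distance is controlled by
        \<open>s k\<close>.\<close>
      have "proj V (u (Suc k)) = x (Suc k)"
        using V(1) xV ux
        by (intro proj_eqI) (auto simp: orthogonal_comp_def orthogonal_def)
      moreover have "proj V (x (Suc k)) = x (Suc k)"
        using V(1) xV subspace_0[OF subspace_orthogonal_comp] by (intro proj_eqI) auto
      ultimately have "G (u (Suc k)) = G (x (Suc k))"
        by (simp add: G_def)
      moreover have "G (x (Suc k)) \<le> G (x k) + g (x k) \<bullet> (x (Suc k) - x k)
          + 1 / \<beta>V / 2 * (norm (x (Suc k) - x k))\<^sup>2"
        using GD G_lip by (rule descent_lemma)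
      moreover have "1 / \<beta>V / 2 * (norm (x (Suc k) - x k))\<^sup>2 \<le> 1 / \<beta>V / 2 * s k"
        using dx \<beta>V_pos by (intro mult_left_mono) auto
      moreover have "G (x k) + g (x k) \<bullet> (xs - x k) \<le> G xs"
        using G_convex GD by (rule convex_gradient_ineq)
      moreover have "g (x k) \<bullet> (u (Suc k) - x (Suc k)) = 0"
        using gV by (rule ux)
      ultimately show "G (u (Suc k)) - G xs \<le> g (x k) \<bullet> (u (Suc k) - xs) + s k / (2 * \<beta>V)"
        by (simp add: inner_simps)
    qed (use \<gamma>_pos[of k] in simp)
    ultimately show ?thesis
      unfolding P_def B_def by (simp add: algebra_simps)
  qed

  \<comment> \<open>Summability of the squared steps and of the divergences\<close>
  have \<delta>_summable: "summable (\<lambda>k. (\<delta> k)\<^sup>2)"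
  proof (rule summable_comparison_test)
    have "norm ((\<delta> k)\<^sup>2) \<le> (\<gamma>max - \<gamma>min) * \<bar>\<gamma> k - \<gamma>lim\<bar>" for k
    proof -
      have "\<bar>\<delta> k\<bar> \<le> \<gamma>max - \<gamma>min"
        using \<gamma>_bounds[of k] \<gamma>_lim(2) by (auto simp: \<delta>_def)
      then have "\<bar>\<delta> k\<bar> * \<bar>\<delta> k\<bar> \<le> (\<gamma>max - \<gamma>min) * \<bar>\<delta> k\<bar>"
        by (intro mult_right_mono) auto
      then show ?thesis
        by (simp add: \<delta>_def power2_eq_square)
    qed
    then show "\<exists>N. \<forall>k\<ge>N. norm ((\<delta> k)\<^sup>2) \<le> (\<gamma>max - \<gamma>min) * \<bar>\<gamma> k - \<gamma>lim\<bar>"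
      by blast
    show "summable (\<lambda>k. (\<gamma>max - \<gamma>min) * \<bar>\<gamma> k - \<gamma>lim\<bar>)"
      using \<gamma>_summable by (intro summable_mult) (simp add: relax_one)
  qed
  define \<epsilon> where "\<epsilon> k = (\<delta> k)\<^sup>2 * (norm vs)\<^sup>2" for k
  have \<epsilon>: "0 \<le> \<epsilon> k" "summable \<epsilon>" for k
    unfolding \<epsilon>_def using \<delta>_summable by (auto intro: summable_mult2)
  \<comment> \<open>The margin left by the bound on the step sizes: the gradient error takes at most
    the share \<open>1 - c\<close> of \<open>s k\<close>.\<close>
  define c where "c = 1 - \<gamma>max / (2 * \<beta>V)"
  have c: "0 < c"
    using \<gamma>max \<beta>V_pos by (simp add: c_def)
  have ratio: "\<gamma> k / (2 * \<beta>V) * s k \<le> (1 - c) * s k" for k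
    unfolding c_def using \<gamma>_bounds(2)[of k] \<beta>V_pos s_nonneg[of k]
    by (intro mult_right_mono) (auto intro: divide_right_mono)
  \<comment> \<open>The weight \<open>a\<close> stays free: \<open>c / 2\<close> below leaves half
    of the margin for the summability of \<open>s\<close>, while 1 suffices once \<open>s\<close> is
    known to be summable.\<close>
  have young: "- 2 * \<delta> k * q k \<le> a * s k + \<epsilon> k / a" if a: "a > 0" for a k
  proof -
    have "0 \<le> (norm (a *\<^sub>R (z (Suc k) - z k) + \<delta> k *\<^sub>R vs))\<^sup>2"
      by simp
    also have "\<dots> = a * (a * s k + 2 * \<delta> k * q k) + \<epsilon> k"
      unfolding s_def \<epsilon>_def q_def power2_norm_eq_inner
      by (simp add: algebra_simps inner_commute power2_eq_square)
    finally show ?thesis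
      using a by (simp add: field_simps)
  qed

  have "summable (\<lambda>k. c / 2 * s k)"
  proof (rule summable_if_telescoping_bound)
    show "c / 2 * s k \<le> E k - E (Suc k) + \<epsilon> k / (c / 2)" for k
    proof -
      have "- ((1 - c) * s k) \<le> E k - E (Suc k) - s k - 2 * \<delta> k * q k"
        using P_lower[of k] ratio[of k] P_eq[of k] by linarith
      then show ?thesis
        using young[of "c / 2" k] c by (simp add: algebra_simps)
    qed
    show "0 \<le> \<epsilon> k / (c / 2)" for k
      using \<epsilon>(1)[of k] c by simp
    show "summable (\<lambda>k. \<epsilon> k / (c / 2))"
      using \<epsilon>(2) by (rule summable_divide)
  qed (use c s_nonneg in \<open>auto simp: E_def\<close>)
  then have "summable (\<lambda>k. 2 / c * (c / 2 * s k))"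
    by (rule summable_mult)
  then have s_summable: "summable s"
    using c by simp

  define d where "d k = B (u k)" for k
  have d_nonneg: "0 \<le> d k" for k
    using B_nonneg uD by (simp add: d_def)
  have "summable (\<lambda>k. \<gamma>min * d (Suc k))"
  proof (rule summable_if_telescoping_bound)
    \<comment> \<open>The term \<open>- s k\<close> in \<open>P_eq\<close> pays for the Young term
      with weight 1; the \<open>s k\<close> remaining from \<open>B_upper\<close> goes into the
      summable error.\<close>
    show "\<gamma>min * d (Suc k) \<le> E k / 2 - E (Suc k) / 2 + (s k + \<epsilon> k)" for k
    proof -
      have "\<gamma>min * d (Suc k) \<le> \<gamma> k * d (Suc k)"
        using \<gamma>_bounds(1) d_nonneg by (rule mult_right_mono)
      moreover have "(1 - c) * s k \<le> s k"
        using c s_nonneg[of k] by (simp add: algebra_simps)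
      ultimately show ?thesis
        using B_upper[of k] P_eq[of k] ratio[of k] young[of 1 k] \<epsilon>(1)[of k]
        unfolding d_def by linarith
    qed
    show "summable (\<lambda>k. s k + \<epsilon> k)"
      using s_summable \<epsilon>(2) by (rule summable_add)
  qed (use \<gamma>min_pos d_nonneg s_nonneg \<epsilon>(1) in \<open>auto simp: E_def\<close>)
  then have "summable (\<lambda>k. 1 / \<gamma>min * (\<gamma>min * d (Suc k)))"
    by (rule summable_mult)
  \<comment> \<open>The estimates start at index 1. Adding \<open>d 0\<close>, which belongs to the
    arbitrary starting point, does not affect summability.\<close>
  then have d_summable: "summable d"
    using \<gamma>min_pos by (simp add: summable_Suc_iff)

  \<comment> \<open>Rate of the best divergence\<close>
  define M where "M k = (INF i\<in>{0..k}. bregman \<Phi> xs vs (u i))" for k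
  have M_eq: "M k = (INF i\<in>{0..k}. ereal (d i))" for k
    unfolding M_def using breg[OF uD] by (simp add: d_def)
  have M_nonneg: "0 \<le> M k" and M_le: "M k \<le> ereal (d k)" for k
    unfolding M_eq using d_nonneg by (auto intro: INF_greatest INF_lower)
  then have M_fin: "\<bar>M k\<bar> \<noteq> \<infinity>" for k
    by (metis MInfty_neq_ereal(1) abs_ereal_ge0 ereal_infty_less_eq(1) PInfty_neq_ereal(1))
  define m where "m k = real_of_ereal (M k)" for k
  have Mm: "M k = ereal (m k)" for k
    using M_fin[of k] by (simp add: m_def ereal_real)
  have m_nonneg: "0 \<le> m k" and m_le: "m k \<le> d k" for k
    using M_nonneg[of k] M_le[of k] by (simp_all add: Mm)
  \<comment> \<open>The estimates do not make \<open>d\<close> itself monotone; its running infimum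
    is, and this upgrades summability to the little-o rate.\<close>
  have "antimono m"
  proof (rule antimonoI)
    fix i j :: nat assume "i \<le> j"
    then have "M j \<le> M i"
      unfolding M_eq by (intro INF_superset_mono) auto
    then show "m j \<le> m i"
      by (simp add: Mm)
  qed
  moreover have "summable m"
    using m_nonneg m_le by (intro summable_comparison_test[OF _ d_summable]) auto
  ultimately have m_smallo: "m \<in> o(\<lambda>k. 1 / (real k + 1))"
    using m_nonneg by (intro antimono_summable_smallo) auto

  \<comment> \<open>Rate at the averaged iterates\<close>
  have ubar_eq: "ubar k = (\<Sum>i=0..k. (1 / (real k + 1)) *\<^sub>R u i)" for k
    by (simp add: ubar_def scaleR_sum_right)
  have weights: "(\<Sum>i=0..k. 1 / (real k + 1)) = 1" for k
    by (simp add: field_simps)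
  have ubarD: "ubar k \<in> ?D" for k
    unfolding ubar_eq using convex_on_imp_convex[OF r_convex] weights uD
    by (intro convex_sum) auto
  \<comment> \<open>Jensen's inequality with equal weights; the total sum of the divergences is the
    constant of the rate.\<close>
  have B_ubar: "B (ubar k) \<le> suminf d * (1 / (real k + 1))" for k
  proof -
    have "B (ubar k) \<le> (\<Sum>i=0..k. (1 / (real k + 1)) * B (u i))"
      unfolding ubar_eq using B_convex weights uD by (intro convex_on_sum) auto
    also have "\<dots> = (\<Sum>i=0..k. d i) * (1 / (real k + 1))"
      by (simp add: d_def sum_divide_distrib)
    also have "\<dots> \<le> suminf d * (1 / (real k + 1))"
      using d_summable d_nonneg by (intro mult_right_mono sum_le_suminf) auto
    finally show ?thesis .
  qed
  have "(\<lambda>k. B (ubar k)) \<in> O(\<lambda>k. 1 / (real k + 1))"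
    using B_ubar B_nonneg[OF ubarD]
    by (intro bigoI[of _ "suminf d"]) (auto intro!: always_eventually)
  then show ?thesis
    using M_fin m_smallo unfolding M_def[symmetric] m_def[symmetric] breg[OF ubarD] by simp
qed

end
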